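(* (Alexander Subbase Theorem) Let $X$ be a topological space and let $\mathscr{D}$ be a subbase of $X$ such that every covering of $X$ by elements of $\mathscr{D}$ has a finite subcovering (i.e. finitely many members of the covering already cover $X$). Then $X$ is quasi-compact.
   Context: Quasi-compact means that every open covering has a finite subcovering (no separation axiom is assumed). A subbase $\mathscr{D}$ of $X$ is a collection of open subsets such that the finite intersections of members of $\mathscr{D}$ (the empty intersection being $X$) form a base of the topology of $X$. *)

theory Defs
  imports "HOL-Analysis.Analysis"
begin

definition base_in :: "'a topology \<Rightarrow> 'a set set \<Rightarrow> bool" where
  "base_in X \<B> \<longleftrightarrow>
     (\<forall>B\<in>\<B>. openin X B) \<and> (\<forall>U. openin X U \<longrightarrow> (\<exists>\<C>. \<C> \<subseteq> \<B> \<and> \<Union>\<C> = U))"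

(* The intersection with the whole space makes the empty intersection equal to
   it (\<Inter>{} is UNIV, which may be larger). *)
definition finite_intersections_in :: "'a topology \<Rightarrow> 'a set set \<Rightarrow> 'a set set" where
  "finite_intersections_in X \<D> = {topspace X \<inter> \<Inter>\<F> |\<F>. finite \<F> \<and> \<F> \<subseteq> \<D>}"

(* The members of a subbase are not required to cover the space. *)
definition subbase_in :: "'a topology \<Rightarrow> 'a set set \<Rightarrow> bool" where
  "subbase_in X \<D> \<longleftrightarrow> (\<forall>D\<in>\<D>. openin X D) \<and> base_in X (finite_intersections_in X \<D>)"

end

theory Submission
  imports Defs
begin

text \<open>
  If some open covering has no finite subcovering, Zorn's lemma gives a maximal one, \<open>\<M>\<close>.
  Whenever \<open>\<M>\<close> contains an open set that includes a finite intersection of subbasic sets, it contains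
  one of these sets: otherwise, by maximality, each of them would cover the space together with
  finitely many members of \<open>\<M>\<close>, and so would their intersection. Hence the subbasic members of \<open>\<M>\<close>
  already cover the space, and the covering hypothesis gives a contradiction.

  This argument is \<open>Alexander_subbase_alt\<close>, for a topology generated by a family that covers
  the space. Two things separate it from the present setting. First, a subbase is given
  here as a family \<open>\<D>\<close> of open sets whose finite intersections form a base;
  this says that the open sets are exactly the unions of such
  intersections, so \<open>\<D>\<close> generates the topology (\<open>topology_generated_by_subbase\<close>). Second, \<open>\<D>\<close> may
  fail to cover the space. Adding the whole space as one more member repairs this: it creates no
  new finite intersections, since the whole space is already the empty one, and it preserves the
  covering hypothesis, since a covering that contains the whole space has a subcovering with this
  one member, while any other covering consists of members of \<open>\<D>\<close>.
\<close>

lemma finite_intersections_in_insert_topspace: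
  "finite_intersections_in X (insert (topspace X) \<D>) = finite_intersections_in X \<D>"
proof
  show "finite_intersections_in X (insert (topspace X) \<D>) \<subseteq> finite_intersections_in X \<D>"
  proof
    fix S assume "S \<in> finite_intersections_in X (insert (topspace X) \<D>)"
    then obtain \<F> where "finite \<F>" "\<F> \<subseteq> insert (topspace X) \<D>" and S: "S = topspace X \<inter> \<Inter>\<F>"
      unfolding finite_intersections_in_def by blast
    then have "finite (\<F> - {topspace X})" "\<F> - {topspace X} \<subseteq> \<D>"
      by auto
    moreover have "S = topspace X \<inter> \<Inter>(\<F> - {topspace X})"
      using S by blast
    ultimately show "S \<in> finite_intersections_in X \<D>"
      unfolding finite_intersections_in_def by blast
  qed
  show "finite_intersections_in X \<D> \<subseteq> finite_intersections_in X (insert (topspace X) \<D>)"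
    unfolding finite_intersections_in_def by blast
qed

lemma subbase_in_insert_topspace:
  assumes "subbase_in X \<D>"
  shows "subbase_in X (insert (topspace X) \<D>)"
  using assms by (simp add: subbase_in_def finite_intersections_in_insert_topspace)

text \<open>The intersection with the whole space in \<^const>\<open>finite_intersections_in\<close> plays the role of
  \<^const>\<open>relative_to\<close>; this connects the two presentations of a generated topology.\<close>

lemma finite_intersections_in_iff:
  "S \<in> finite_intersections_in X \<D> \<longleftrightarrow>
    (finite intersection_of (\<lambda>D. D \<in> \<D>) relative_to topspace X) S"
  unfolding finite_intersections_in_def relative_to_def intersection_of_def by auto

lemma openin_iff_union_of_base:
  assumes "base_in X \<B>"
  shows "openin X U \<longleftrightarrow> (arbitrary union_of (\<lambda>B. B \<in> \<B>)) U"
  using assms unfolding base_in_def union_of_def arbitrary_def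
  by (auto simp: subset_iff)

lemma topology_generated_by_subbase:
  assumes "subbase_in X \<D>"
  shows "topology (arbitrary union_of
           (finite intersection_of (\<lambda>D. D \<in> \<D>) relative_to topspace X)) = X"
proof -
  have "base_in X (finite_intersections_in X \<D>)"
    using assms by (simp add: subbase_in_def)
  then have "openin X = arbitrary union_of
           (finite intersection_of (\<lambda>D. D \<in> \<D>) relative_to topspace X)"
    by (simp add: fun_eq_iff openin_iff_union_of_base finite_intersections_in_iff)
  then show ?thesis
    by (metis openin_inverse)
qed

theorem corollary3p3:
  fixes X :: "'a topology" and \<D> :: "'a set set"
  assumes subbase: "subbase_in X \<D>"
    and cover: "\<And>\<C>. \<C> \<subseteq> \<D> \<Longrightarrow> topspace X \<subseteq> \<Union>\<C> \<Longrightarrow>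
      \<exists>\<F>. finite \<F> \<and> \<F> \<subseteq> \<C> \<and> topspace X \<subseteq> \<Union>\<F>"
  shows "compact_space X"
proof (rule Alexander_subbase_alt)
  show "topspace X \<subseteq> \<Union>(insert (topspace X) \<D>)"
    by blast
  show "topology (arbitrary union_of
          (finite intersection_of (\<lambda>D. D \<in> insert (topspace X) \<D>) relative_to topspace X)) = X"
    by (rule topology_generated_by_subbase[OF subbase_in_insert_topspace[OF subbase]])
  show "\<exists>\<F>. finite \<F> \<and> \<F> \<subseteq> \<C> \<and> topspace X \<subseteq> \<Union>\<F>"
    if "\<C> \<subseteq> insert (topspace X) \<D>" and "topspace X \<subseteq> \<Union>\<C>" for \<C>
  proof (cases "topspace X \<in> \<C>")
    case True
    then show ?thesis
      by (intro exI[of _ "{topspace X}"]) simp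
  next
    case False
    with that show ?thesis
      by (intro cover) auto
  qed
qed

end
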